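(* Let $d\ge 1$, let $\mathbf{n}=(n_1,\ldots,n_d)$ be a $d$-tuple of positive integers, and let $s$ be a positive integer. Let $\Sigma^1_{\mathbf{n},s}$ denote the sum (componentwise) of all tensors in $\mathcal{T}^1_{\mathbf{n},s}$. Then for each $\mathbf{x}=(x_1,\ldots,x_d)\in \Pi_{\mathbf{n}}$, \[ \Sigma^{1}_{\mathbf{n},s}[\mathbf{x}] = \sum_{j=1}^s \prod_{i=1}^d \binom{x_i + j - 2}{j-1} \binom{n_i - x_i + s - j}{s -j}. \]
   Context: $\Pi_{\mathbf{n}}=[n_1]\times\cdots\times[n_d]$ (where $[m]=\{1,\ldots,m\}$) with the product order: $\mathbf a\le\mathbf b$ iff $a_i\le b_i$ for all $i$. A tensor $T\in\mathbb{R}^{n_1}\otimes\cdots\otimes\mathbb{R}^{n_d}$ is identified with its array of components $T[\mathbf{x}]$, $\mathbf{x}\in\Pi_{\mathbf{n}}$. Its support is $\{\mathbf{x}: T[\mathbf{x}]\neq 0\}$, and $T$ has width one if its support is a chain (totally ordered subset) of $\Pi_{\mathbf{n}}$. $\mathcal{T}^1_{\mathbf{n},s}$ is the set of all width-one tensors $T$ with $T[\mathbf{x}]\in\mathbb{Z}_{\ge 0}$ for all $\mathbf{x}$ and $\sum_{\mathbf{x}}T[\mathbf{x}]=s$. *)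

theory Defs
  imports Complex_Main "HOL-Library.FuncSet"
begin

text \<open>A \<open>d\<close>-tuple is a function on \<open>{1..d}\<close>, extended by \<open>undefined\<close>. On such tuples the
  pointwise order \<open>\<le>\<close> of the function type is exactly the product order, since any two of them
  agree outside \<open>{1..d}\<close>.\<close>

definition index_box :: "nat \<Rightarrow> (nat \<Rightarrow> nat) \<Rightarrow> (nat \<Rightarrow> nat) set" where
  "index_box d n = (\<Pi>\<^sub>E i\<in>{1..d}. {1..n i})"

text \<open>A tensor is its array of components. Extensionality outside the box makes distinct
  functions distinct tensors, so that sums over sets of tensors count each tensor once.\<close>

type_synonym tensor = "(nat \<Rightarrow> nat) \<Rightarrow> real"

definition tensors :: "nat \<Rightarrow> (nat \<Rightarrow> nat) \<Rightarrow> tensor set" where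
  "tensors d n = (index_box d n \<rightarrow>\<^sub>E UNIV)"

definition tensor_support :: "nat \<Rightarrow> (nat \<Rightarrow> nat) \<Rightarrow> tensor \<Rightarrow> (nat \<Rightarrow> nat) set" where
  "tensor_support d n T = {x \<in> index_box d n. T x \<noteq> 0}"

definition width_one :: "nat \<Rightarrow> (nat \<Rightarrow> nat) \<Rightarrow> tensor \<Rightarrow> bool" where
  "width_one d n T \<longleftrightarrow> Complete_Partial_Order.chain (\<le>) (tensor_support d n T)"

definition width_one_tensors :: "nat \<Rightarrow> (nat \<Rightarrow> nat) \<Rightarrow> nat \<Rightarrow> tensor set" where
  "width_one_tensors d n s =
     {T \<in> tensors d n. width_one d n T \<and> (\<forall>x\<in>index_box d n. T x \<in> \<nat>) \<and>
        (\<Sum>x\<in>index_box d n. T x) = real s}"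

definition sum_width_one :: "nat \<Rightarrow> (nat \<Rightarrow> nat) \<Rightarrow> nat \<Rightarrow> tensor" where
  "sum_width_one d n s = (\<lambda>x\<in>index_box d n. \<Sum>T\<in>width_one_tensors d n s. T x)"

lemma finite_index_box: "finite (index_box d n)"
  unfolding index_box_def by (intro finite_PiE) auto

text \<open>Hence the sum in \<open>sum_width_one\<close> is a genuine finite sum.\<close>

lemma finite_width_one_tensors: "finite (width_one_tensors d n s)"
proof (rule finite_subset)
  show "width_one_tensors d n s \<subseteq> (index_box d n \<rightarrow>\<^sub>E real ` {..s})"
  proof
    fix T assume T: "T \<in> width_one_tensors d n s"
    have "T x \<in> real ` {..s}" if x: "x \<in> index_box d n" for x
    proof -
      have nonneg: "T y \<ge> 0" if "y \<in> index_box d n" for y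
        using T that by (auto simp: width_one_tensors_def elim!: Nats_cases)
      have "T x \<le> (\<Sum>y\<in>index_box d n. T y)"
        using x nonneg by (intro member_le_sum finite_index_box) auto
      also have "\<dots> = real s"
        using T by (simp add: width_one_tensors_def)
      finally have "T x \<le> real s" .
      moreover obtain k where "T x = real k"
        using T x by (auto simp: width_one_tensors_def elim!: Nats_cases)
      ultimately show ?thesis by auto
    qed
    then show "T \<in> (index_box d n \<rightarrow>\<^sub>E real ` {..s})"
      using T by (auto simp: width_one_tensors_def tensors_def PiE_iff)
  qed
  show "finite (index_box d n \<rightarrow>\<^sub>E real ` {..s})"
    by (intro finite_PiE finite_index_box) auto
qed

end

theory Submission
  imports Defs "HOL-Library.Multiset"
begin

text \<open>A width-one tensor with nonnegative integer entries summing to \<open>s\<close> is a multiset of size \<open>s\<close>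
  supported on a chain, that is, a weakly increasing list of length \<open>s\<close> of points of the box.
  Hence the sum of all these tensors at \<open>x\<close> counts the pairs of such a list and a position \<open>j\<close>
  whose entry is \<open>x\<close>. For fixed \<open>j\<close> the lists split into their coordinates, and in each coordinate
  they split at position \<open>j\<close> into a weakly increasing list in \<open>{1..x i}\<close> and one in
  \<open>{x i..n i}\<close>.\<close>

section \<open>Counting weakly increasing lists, first in an interval and then in the box\<close>

text \<open>\<open>sorted_wrt (\<le>)\<close> instead of \<open>sorted\<close> lets one definition
  serve both intervals of numbers and the box, whose points are only partially ordered. Transitivity
  makes the entries of such a list pairwise comparable.\<close>

definition sorted_lists :: "'a::order set \<Rightarrow> nat \<Rightarrow> 'a list set" where
  "sorted_lists A k = {xs. sorted_wrt (\<le>) xs \<and> set xs \<subseteq> A \<and> length xs = k}"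

lemma sorted_lists_0 [simp]: "sorted_lists A 0 = {[]}"
  by (auto simp: sorted_lists_def)

lemma finite_sorted_lists: "finite A \<Longrightarrow> finite (sorted_lists A k)"
  by (rule finite_subset[OF _ finite_lists_length_eq[of A k]]) (auto simp: sorted_lists_def)

text \<open>Split on whether the head is \<open>a\<close>; if it is not, sortedness pushes every
  entry above \<open>a\<close>. This is the combinatorial form of Pascal's rule.\<close>

lemma sorted_lists_Suc_interval:
  fixes a b :: nat
  assumes "a \<le> b"
  shows "sorted_lists {a..b} (Suc k) =
    (#) a ` sorted_lists {a..b} k \<union> sorted_lists {Suc a..b} (Suc k)"
proof (intro equalityI subsetI)
  fix xs assume xs: "xs \<in> sorted_lists {a..b} (Suc k)"
  then obtain y ys where y: "xs = y # ys" "length ys = k"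
    by (auto simp: sorted_lists_def length_Suc_conv)
  show "xs \<in> (#) a ` sorted_lists {a..b} k \<union> sorted_lists {Suc a..b} (Suc k)"
  proof (cases "y = a")
    case True
    then show ?thesis using xs y by (auto simp: sorted_lists_def)
  next
    case False
    then have "Suc a \<le> z" if "z \<in> set xs" for z
      using xs y that by (force simp: sorted_lists_def)
    then show ?thesis using xs by (auto simp: sorted_lists_def)
  qed
next
  fix xs
  assume "xs \<in> (#) a ` sorted_lists {a..b} k \<union> sorted_lists {Suc a..b} (Suc k)"
  then show "xs \<in> sorted_lists {a..b} (Suc k)"
    using assms by (force simp: sorted_lists_def)
qed

text \<open>Stars and bars, by the recursion above and Pascal's rule. Each branch of the recursion
  shortens either the list or the interval, hence the induction on
  \<open>Suc b - a + k\<close>.\<close>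

lemma card_sorted_lists_interval:
  fixes a b :: nat
  shows "card (sorted_lists {a..b} k) = (Suc b - a + k - 1) choose k"
proof (induction "Suc b - a + k" arbitrary: a k rule: less_induct)
  case less
  show ?case
  proof (cases k)
    case (Suc l)
    show ?thesis
    proof (cases "a \<le> b")
      case True
      have disj: "(#) a ` sorted_lists {a..b} l \<inter> sorted_lists {Suc a..b} (Suc l) = {}"
        by (auto simp: sorted_lists_def)
      have "card (sorted_lists {a..b} k) =
          card (sorted_lists {a..b} l) + card (sorted_lists {Suc a..b} (Suc l))"
        unfolding Suc sorted_lists_Suc_interval[OF True]
        by (subst card_Un_disjoint) (auto simp: disj finite_sorted_lists card_image)
      also have "card (sorted_lists {a..b} l) = (Suc b - a + l - 1) choose l"
        using Suc by (intro less) auto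
      also have "card (sorted_lists {Suc a..b} (Suc l)) = (Suc b - Suc a + Suc l - 1) choose Suc l"
        using Suc True by (intro less) auto
      also have "((Suc b - a + l - 1) choose l) + ((Suc b - Suc a + Suc l - 1) choose Suc l) =
          (Suc b - a + k - 1) choose k"
        using True Suc by (simp add: Suc_diff_le)
      finally show ?thesis .
    next
      \<comment> \<open>For an empty interval \<open>Suc b - a\<close> is truncated to 0, and the
        formula becomes \<open>l choose Suc l\<close>, which is 0.\<close>
      case False
      then have "sorted_lists {a..b} k = {}"
        using Suc by (auto simp: sorted_lists_def)
      then show ?thesis using False Suc by simp
    qed
  qed simp
qed

text \<open>Positions are counted from 0, so \<open>j\<close> entries stand before the fixed entry
  \<open>m\<close> and \<open>s - Suc j\<close> after it. Given \<open>m\<close>, the two pieces can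
  be chosen independently.\<close>

lemma card_sorted_lists_nth:
  fixes m n j s :: nat
  assumes "m \<in> {1..n}" "j < s"
  shows "card {xs \<in> sorted_lists {1..n} s. xs ! j = m} =
    ((m + j - 1) choose j) * ((n - m + s - Suc j) choose (s - Suc j))"
proof -
  let ?A = "{xs \<in> sorted_lists {1..n} s. xs ! j = m}"
  let ?B = "sorted_lists {1..m} j \<times> sorted_lists {m..n} (s - Suc j)"
  have "bij_betw (\<lambda>(us, vs). us @ m # vs) ?B ?A"
  proof (rule bij_betw_byWitness[where f' = "\<lambda>xs. (take j xs, drop (Suc j) xs)"])
    show "\<forall>p\<in>?B. (\<lambda>xs. (take j xs, drop (Suc j) xs)) ((\<lambda>(us, vs). us @ m # vs) p) = p"
      by (auto simp: sorted_lists_def)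
    have "take j xs @ m # drop (Suc j) xs = xs" if "xs \<in> ?A" for xs
      using that assms id_take_nth_drop[of j xs] by (auto simp: sorted_lists_def)
    then show "\<forall>xs\<in>?A. (\<lambda>(us, vs). us @ m # vs) (take j xs, drop (Suc j) xs) = xs"
      by simp
    show "(\<lambda>(us, vs). us @ m # vs) ` ?B \<subseteq> ?A"
    proof clarify
      fix us vs
      assume "us \<in> sorted_lists {1..m} j" "vs \<in> sorted_lists {m..n} (s - Suc j)"
      then show "us @ m # vs \<in> sorted_lists {1..n} s \<and> (us @ m # vs) ! j = m"
        using assms
        by (fastforce simp: sorted_lists_def sorted_wrt_append nth_append)
    qed
    show "(\<lambda>xs. (take j xs, drop (Suc j) xs)) ` ?A \<subseteq> ?B"
    proof clarify
      fix xs assume xs: "xs \<in> sorted_lists {1..n} s" "m = xs ! j"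
      then have "sorted_wrt (\<le>) (take j xs @ xs ! j # drop (Suc j) xs)"
        "set (take j xs @ xs ! j # drop (Suc j) xs) \<subseteq> {1..n}"
        using assms id_take_nth_drop[of j xs] by (auto simp: sorted_lists_def)
      then show "take j xs \<in> sorted_lists {1..xs ! j} j \<and>
          drop (Suc j) xs \<in> sorted_lists {xs ! j..n} (s - Suc j)"
        using xs assms by (auto simp: sorted_lists_def sorted_wrt_append)
    qed
  qed
  then have "card ?A = card ?B"
    by (simp add: bij_betw_same_card)
  also have "\<dots> = ((m + j - 1) choose j) * ((n - m + s - Suc j) choose (s - Suc j))"
    using assms by (simp add: card_cartesian_product card_sorted_lists_interval Suc_diff_le)
  finally show ?thesis .
qed

text \<open>The order on the box is coordinatewise, so transposing a list of points into a tuple of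
  coordinate lists turns both sortedness and the condition at position \<open>j\<close> into
  independent conditions on the coordinates.\<close>

lemma card_sorted_box_lists_nth:
  assumes "x \<in> index_box d n" "j < s"
  shows "card {xs \<in> sorted_lists (index_box d n) s. xs ! j = x} =
    (\<Prod>i = 1..d. ((x i + j - 1) choose j) * ((n i - x i + s - Suc j) choose (s - Suc j)))"
proof -
  let ?A = "{xs \<in> sorted_lists (index_box d n) s. xs ! j = x}"
  let ?C = "\<lambda>i. {ys \<in> sorted_lists {1..n i} s. ys ! j = x i}"
  \<comment> \<open>\<open>?f\<close> and \<open>?g\<close> are the two directions of the
    transposition. Restricting to \<open>{1..d}\<close> makes their tuples extensional, as
    membership in the product sets requires.\<close>
  let ?f = "\<lambda>xs. \<lambda>i\<in>{1..d}. map (\<lambda>y. y i) xs"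
  let ?g = "\<lambda>F. map (\<lambda>k. \<lambda>i\<in>{1..d}. F i ! k) [0..<s]"
  have "bij_betw ?f ?A (\<Pi>\<^sub>E i\<in>{1..d}. ?C i)"
  proof (rule bij_betw_byWitness[where f' = ?g])
    show "\<forall>xs\<in>?A. ?g (?f xs) = xs"
    proof clarify
      fix xs assume xs: "xs \<in> sorted_lists (index_box d n) s"
      have "(\<lambda>i\<in>{1..d}. ?f xs i ! k) = xs ! k" if "k < s" for k
      proof -
        have "xs ! k \<in> index_box d n"
          using xs that by (force simp: sorted_lists_def)
        moreover have "(\<lambda>i\<in>{1..d}. ?f xs i ! k) = restrict (xs ! k) {1..d}"
          using xs that by (intro restrict_ext) (auto simp: sorted_lists_def)
        ultimately show ?thesis
          by (simp add: index_box_def PiE_restrict)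
      qed
      then show "?g (?f xs) = xs"
        using xs by (intro nth_equalityI) (auto simp: sorted_lists_def)
    qed
    show "\<forall>F\<in>(\<Pi>\<^sub>E i\<in>{1..d}. ?C i). ?f (?g F) = F"
    proof
      fix F assume F: "F \<in> (\<Pi>\<^sub>E i\<in>{1..d}. ?C i)"
      have "map (\<lambda>y. y i) (?g F) = F i" if "i \<in> {1..d}" for i
      proof (rule nth_equalityI)
        show "length (map (\<lambda>y. y i) (?g F)) = length (F i)"
          using F that by (auto simp: sorted_lists_def PiE_iff)
      qed (use that in auto)
      then have "?f (?g F) = restrict F {1..d}"
        by (intro restrict_ext) simp
      then show "?f (?g F) = F"
        using PiE_restrict[OF F] by simp
    qed
    show "?f ` ?A \<subseteq> (\<Pi>\<^sub>E i\<in>{1..d}. ?C i)"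
    proof clarify
      fix xs assume xs: "xs \<in> sorted_lists (index_box d n) s" "x = xs ! j"
      show "?f xs \<in> (\<Pi>\<^sub>E i\<in>{1..d}. {ys \<in> sorted_lists {1..n i} s. ys ! j = (xs ! j) i})"
      proof (rule restrict_PiE_iff[THEN iffD2], rule ballI)
        fix i assume i: "i \<in> {1..d}"
        have "sorted_wrt (\<le>) (map (\<lambda>y. y i) xs)"
          using xs sorted_wrt_mono_rel[of xs "(\<le>)" "\<lambda>y z. y i \<le> z i"]
          by (auto simp: sorted_lists_def sorted_wrt_map le_fun_def)
        then show "map (\<lambda>y. y i) xs \<in> {ys \<in> sorted_lists {1..n i} s. ys ! j = (xs ! j) i}"
          using xs i assms(2) by (fastforce simp: sorted_lists_def index_box_def PiE_iff)
      qed
    qed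
    show "?g ` (\<Pi>\<^sub>E i\<in>{1..d}. ?C i) \<subseteq> ?A"
    proof (rule image_subsetI)
      fix F assume F: "F \<in> (\<Pi>\<^sub>E i\<in>{1..d}. ?C i)"
      have mem: "F i ! k \<in> {1..n i}" if "i \<in> {1..d}" "k < s" for i k
      proof -
        have "F i \<in> ?C i" using F that by (auto simp: PiE_iff)
        then show ?thesis
          using that(2) nth_mem[of k "F i"] by (auto simp: sorted_lists_def simp del: nth_mem)
      qed
      have mono: "F i ! k \<le> F i ! l" if "i \<in> {1..d}" "k < l" "l < s" for i k l
      proof -
        have "F i \<in> ?C i" using F that by (auto simp: PiE_iff)
        then show ?thesis
          using that by (auto simp: sorted_lists_def intro: sorted_wrt_nth_less)
      qed
      have "(\<lambda>i\<in>{1..d}. F i ! j) = restrict x {1..d}"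
        using F by (intro restrict_ext) (auto simp: PiE_iff)
      then have "?g F ! j = x"
        using assms by (simp add: index_box_def PiE_restrict)
      \<comment> \<open>Outside \<open>{1..d}\<close> all points of \<open>?g F\<close> have the
        value \<open>undefined\<close>, so the function order holds there and \<open>mono\<close>
        supplies the remaining coordinates.\<close>
      then show "?g F \<in> ?A"
        using mem mono
        by (auto simp: sorted_lists_def index_box_def sorted_wrt_iff_nth_less le_fun_def)
    qed
  qed
  then have "card ?A = (\<Prod>i = 1..d. card (?C i))"
    by (simp add: bij_betw_same_card card_PiE)
  also have "\<dots> = (\<Prod>i = 1..d. ((x i + j - 1) choose j) *
      ((n i - x i + s - Suc j) choose (s - Suc j)))"
    using assms by (intro prod.cong refl card_sorted_lists_nth) (auto simp: index_box_def PiE_iff)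
  finally show ?thesis .
qed

section \<open>Width-one tensors as sorted lists\<close>

lemma sorted_wrt_le_mset_unique:
  fixes xs ys :: "'a::order list"
  assumes "sorted_wrt (\<le>) xs" "sorted_wrt (\<le>) ys" "mset xs = mset ys"
  shows "xs = ys"
  using assms
proof (induction xs arbitrary: ys)
  case (Cons a xs)
  then obtain b zs where ys: "ys = b # zs"
    by (cases ys) auto
  have "a \<in> set ys" "b \<in> set (a # xs)"
    using Cons.prems(3) ys by (metis list.set_intros(1) mset_eq_setD)+
  \<comment> \<open>Each head is the least entry of its own list and occurs in the other list, so
    each is below the other.\<close>
  then have "a = b"
    using Cons.prems ys by (auto intro: order.antisym)
  then show ?case
    using Cons ys by auto
qed simp

text \<open>Selection sort: take out one copy of a minimal element, sort the rest, and put the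
  element in front.\<close>

lemma chain_multiset_sorted_list:
  fixes M :: "'a::order multiset"
  assumes "Complete_Partial_Order.chain (\<le>) (set_mset M)"
  shows "\<exists>xs. sorted_wrt (\<le>) xs \<and> mset xs = M"
  using assms
proof (induction M rule: measure_induct_rule[where f = size])
  case (less M)
  show ?case
  proof (cases "M = {#}")
    case False
    then obtain m where m: "m \<in># M" "\<And>y. y \<in># M \<Longrightarrow> y \<le> m \<Longrightarrow> m = y"
      using finite_has_minimal[of "set_mset M"] by auto
    \<comment> \<open>In a chain a minimal element is comparable with every other element, hence
      least.\<close>
    have le: "m \<le> y" if "y \<in># M" for y
      using chainD[OF less.prems m(1) that] m(2)[OF that] by auto
    have "size (M - {#m#}) < size M"
      using m(1) by (simp add: size_Diff1_less)
    moreover have "Complete_Partial_Order.chain (\<le>) (set_mset (M - {#m#}))"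
      using less.prems by (rule chain_subset) (auto dest: in_diffD)
    ultimately obtain xs where xs: "sorted_wrt (\<le>) xs" "mset xs = M - {#m#}"
      using less.IH by blast
    have "set xs \<subseteq> set_mset M"
      using arg_cong[OF xs(2), of set_mset] by (auto dest: in_diffD)
    then have "sorted_wrt (\<le>) (m # xs)" "mset (m # xs) = M"
      using xs le m(1) by auto
    then show ?thesis by blast
  qed (auto intro: exI[of _ "[]"])
qed

lemma sorted_wrt_imp_chain:
  assumes "sorted_wrt (\<le>) (xs :: 'a::order list)"
  shows "Complete_Partial_Order.chain (\<le>) (set xs)"
  using assms by (induction xs) (auto simp: chain_def)

definition list_tensor :: "nat \<Rightarrow> (nat \<Rightarrow> nat) \<Rightarrow> (nat \<Rightarrow> nat) list \<Rightarrow> tensor" where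
  "list_tensor d n xs = (\<lambda>x\<in>index_box d n. real (count_list xs x))"

text \<open>Injectivity: the entries of the tensor are multiplicities, and a multiset has at most
  one sorted listing. Surjectivity: the entries define a multiset supported on a chain, which can be
  sorted.\<close>

lemma bij_betw_list_tensor:
  "bij_betw (list_tensor d n) (sorted_lists (index_box d n) s) (width_one_tensors d n s)"
  unfolding bij_betw_def
proof (intro conjI equalityI subsetI inj_onI)
  fix xs ys
  assume xs: "xs \<in> sorted_lists (index_box d n) s" and ys: "ys \<in> sorted_lists (index_box d n) s"
    and eq: "list_tensor d n xs = list_tensor d n ys"
  have "count_list xs y = count_list ys y" for y
  proof (cases "y \<in> index_box d n")
    case True
    then show ?thesis using fun_cong[OF eq, of y] by (simp add: list_tensor_def)
  next
    case False
    then have "y \<notin> set xs" "y \<notin> set ys"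
      using xs ys by (auto simp: sorted_lists_def)
    then show ?thesis by simp
  qed
  then have "mset xs = mset ys"
    by (simp add: multiset_eq_iff count_mset)
  then show "xs = ys"
    using xs ys by (auto simp: sorted_lists_def intro: sorted_wrt_le_mset_unique)
next
  fix T assume "T \<in> list_tensor d n ` sorted_lists (index_box d n) s"
  then obtain xs where xs: "sorted_wrt (\<le>) xs" "set xs \<subseteq> index_box d n" "length xs = s"
    and T: "T = list_tensor d n xs"
    by (auto simp: sorted_lists_def)
  have "tensor_support d n T = set xs"
    using xs(2) by (auto simp: tensor_support_def T list_tensor_def count_list_0_iff)
  then have "width_one d n T"
    using sorted_wrt_imp_chain[OF xs(1)] by (simp add: width_one_def)
  moreover have "(\<Sum>x\<in>index_box d n. T x) = real s"
    using sum_count_set[OF xs(2) finite_index_box] xs(3)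
    by (simp add: T list_tensor_def flip: of_nat_sum)
  ultimately show "T \<in> width_one_tensors d n s"
    by (auto simp: width_one_tensors_def tensors_def T list_tensor_def)
next
  fix T assume T: "T \<in> width_one_tensors d n s"
  let ?B = "index_box d n"
  \<comment> \<open>The entries are natural numbers of type \<open>real\<close>, so the floor
    recovers them exactly. Points outside the box get multiplicity 0, since \<open>T\<close> is
    \<open>undefined\<close> there.\<close>
  define M where "M = Abs_multiset (\<lambda>x. if x \<in> ?B then nat \<lfloor>T x\<rfloor> else 0)"
  have "finite {x. 0 < (if x \<in> ?B then nat \<lfloor>T x\<rfloor> else 0)}"
    by (rule finite_subset[OF _ finite_index_box[of d n]]) auto
  then have count_M: "count M x = (if x \<in> ?B then nat \<lfloor>T x\<rfloor> else 0)" for x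
    by (simp add: M_def count_Abs_multiset)
  have T_nat: "T x = real (count M x)" if "x \<in> ?B" for x
    using T that by (auto simp: width_one_tensors_def count_M elim!: Nats_cases)
  have set_M: "set_mset M = tensor_support d n T"
  proof (rule set_eqI)
    fix x
    show "x \<in># M \<longleftrightarrow> x \<in> tensor_support d n T"
    proof (cases "x \<in> ?B")
      case True
      then show ?thesis
        by (simp add: tensor_support_def T_nat)
    next
      case False
      then have "count M x = 0"
        by (simp add: count_M)
      then show ?thesis
        using False by (simp add: tensor_support_def count_eq_zero_iff)
    qed
  qed
  then have "Complete_Partial_Order.chain (\<le>) (set_mset M)"
    using T by (simp add: width_one_tensors_def width_one_def)
  then obtain xs where xs: "sorted_wrt (\<le>) xs" "mset xs = M"
    using chain_multiset_sorted_list by blast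
  have sub: "set xs \<subseteq> ?B"
    using set_M xs(2) by (auto simp: tensor_support_def simp flip: set_mset_mset)
  have T_eq: "T x = real (count_list xs x)" if "x \<in> ?B" for x
    using T_nat[OF that] xs(2) by (metis count_mset)
  have "real (length xs) = (\<Sum>x\<in>?B. T x)"
    using sum_count_set[OF sub finite_index_box] T_eq by (simp flip: of_nat_sum)
  then have "length xs = s"
    using T by (simp add: width_one_tensors_def)
  moreover have "list_tensor d n xs = T"
    using T T_eq
    by (auto simp: list_tensor_def width_one_tensors_def tensors_def PiE_iff extensional_def
        fun_eq_iff)
  ultimately show "T \<in> list_tensor d n ` sorted_lists ?B s"
    using xs(1) sub by (auto simp: sorted_lists_def)
qed

section \<open>Summation over list positions\<close>

lemma count_list_eq_sum_nth: "count_list xs x = (\<Sum>j<length xs. if xs ! j = x then 1 else 0)"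
  by (induction xs) (auto simp: sum.lessThan_Suc_shift simp del: sum.lessThan_Suc)

theorem theorem3p1:
  fixes d s :: nat and n x :: "nat \<Rightarrow> nat"
  assumes "d \<ge> 1"
    and "\<And>i. i \<in> {1..d} \<Longrightarrow> n i \<ge> 1"
    and "s \<ge> 1"
    and "x \<in> index_box d n"
  shows "sum_width_one d n s x =
    (\<Sum>j = 1..s. \<Prod>i = 1..d.
      real ((x i + j - 2) choose (j - 1)) * real ((n i - x i + s - j) choose (s - j)))"
proof -
  let ?L = "sorted_lists (index_box d n) s"
  have "sum_width_one d n s x = (\<Sum>T\<in>width_one_tensors d n s. T x)"
    using assms(4) by (simp add: sum_width_one_def)
  also have "\<dots> = (\<Sum>xs\<in>?L. list_tensor d n xs x)"
    by (rule sum.reindex_bij_betw[OF bij_betw_list_tensor, symmetric])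
  also have "\<dots> = (\<Sum>xs\<in>?L. \<Sum>j<s. if xs ! j = x then 1 else 0)"
    using assms(4) by (intro sum.cong refl)
      (auto simp: list_tensor_def count_list_eq_sum_nth sorted_lists_def intro!: sum.cong)
  \<comment> \<open>Count the pairs of a list and a position holding \<open>x\<close> by position
    first, so that each inner sum is the cardinality already computed.\<close>
  also have "\<dots> = (\<Sum>j<s. \<Sum>xs\<in>?L. if xs ! j = x then 1 else 0)"
    by (rule sum.swap)
  also have "\<dots> = (\<Sum>j<s. real (card {xs \<in> ?L. xs ! j = x}))"
    by (simp add: finite_sorted_lists finite_index_box Int_def flip: sum.inter_filter)
  \<comment> \<open>The factors are written in terms of \<open>Suc j\<close>, so that passing from
    positions \<open>0..s - 1\<close> to the summation range \<open>1..s\<close> is a mere shift of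
    the index.\<close>
  also have "\<dots> = (\<Sum>j<s. \<Prod>i = 1..d.
      real ((x i + Suc j - 2) choose (Suc j - 1)) * real ((n i - x i + s - Suc j) choose (s - Suc j)))"
    using assms(4) by (intro sum.cong refl) (simp add: card_sorted_box_lists_nth)
  also have "\<dots> = (\<Sum>j = 1..s. \<Prod>i = 1..d.
      real ((x i + j - 2) choose (j - 1)) * real ((n i - x i + s - j) choose (s - j)))"
    by (rule sum.reindex_bij_witness[of _ "\<lambda>j. j - 1" Suc]) auto
  finally show ?thesis .
qed

end
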